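(* Let $L:\mathbb{R}^n\times\mathbb{R}^m\to\mathbb{R}$ be a $C^2$ convex concave function with at least one equilibrium, whose Hessian is invertible at every equilibrium of $L$. For $\lambda>0$ let $$L'(x,y)=L(x,y)+\frac{\lambda}{2}\|x\|^2-\frac{\lambda}{2}\|y\|^2 .$$ Then for each $\epsilon>0$ there is $\lambda>0$ such that $L'$ has equilibria that are $\epsilon$-close to those of $L$; that is, for every equilibrium $(x^*,y^* )$ of $L$ there is an equilibrium $(x',y')$ of $L'$ with $\|x'-x^*\|^2+\|y'-y^*\|^2\le\epsilon^2$.
   Context: Convex concave: $L(\cdot,y)$ is convex for every $y\in\mathbb{R}^m$ and $L(x,\cdot)$ is concave for every $x\in\mathbb{R}^n$. An equilibrium of $L$ is a pair $(p,q)$ with $L(p,y)\le L(p,q)\le L(x,q)$ for all $x\in\mathbb{R}^n$, $y\in\mathbb{R}^m$ (for convex concave differentiable $L$, equivalently a stationary point of $L$). The norm is Euclidean. *)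

theory Defs
  imports "HOL-Analysis.Analysis"
begin

definition C2 :: "('a::real_normed_vector \<Rightarrow> 'b::real_normed_vector) \<Rightarrow> bool" where
  "C2 f \<longleftrightarrow>
     (\<exists>(f' :: 'a \<Rightarrow> 'a \<Rightarrow>\<^sub>L 'b) (f'' :: 'a \<Rightarrow> 'a \<Rightarrow>\<^sub>L ('a \<Rightarrow>\<^sub>L 'b)).
        (\<forall>z. (f has_derivative blinfun_apply (f' z)) (at z)) \<and>
        (\<forall>z. (f' has_derivative blinfun_apply (f'' z)) (at z)) \<and>
        continuous_on UNIV f'')"

definition convex_concave :: "('a::real_vector \<times> 'b::real_vector \<Rightarrow> real) \<Rightarrow> bool" where
  "convex_concave L \<longleftrightarrow>
     (\<forall>y. convex_on UNIV (\<lambda>x. L (x, y))) \<and> (\<forall>x. concave_on UNIV (\<lambda>y. L (x, y)))"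

definition equilibrium :: "('a \<times> 'b \<Rightarrow> real) \<Rightarrow> 'a \<times> 'b \<Rightarrow> bool" where
  "equilibrium L z \<longleftrightarrow>
     (case z of (p, q) \<Rightarrow> \<forall>x y. L (p, y) \<le> L (p, q) \<and> L (p, q) \<le> L (x, q))"

definition dir_deriv :: "'a::real_normed_vector \<Rightarrow> ('a \<Rightarrow> real) \<Rightarrow> 'a \<Rightarrow> real" where
  "dir_deriv v f z = deriv (\<lambda>t. f (z + t *\<^sub>R v)) 0"

text \<open>
  The standard basis of \<open>real^'n \<times> real^'m\<close>, indexed by the sum type so that
  the Hessian is a square matrix in the library's sense.
\<close>

definition unit_vec :: "'n + 'm \<Rightarrow> (real ^ 'n) \<times> (real ^ 'm)" where
  "unit_vec k = (case k of Inl i \<Rightarrow> (axis i 1, 0) | Inr j \<Rightarrow> (0, axis j 1))"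

definition hessian ::
  "((real ^ 'n) \<times> (real ^ 'm) \<Rightarrow> real) \<Rightarrow> (real ^ 'n) \<times> (real ^ 'm) \<Rightarrow> real ^ ('n + 'm) ^ ('n + 'm)" where
  "hessian f z = (\<chi> i j. dir_deriv (unit_vec i) (dir_deriv (unit_vec j) f) z)"

definition regularized ::
  "real \<Rightarrow> ('a::real_normed_vector \<times> 'b::real_normed_vector \<Rightarrow> real) \<Rightarrow> 'a \<times> 'b \<Rightarrow> real" where
  "regularized r L = (\<lambda>(x, y). L (x, y) + r / 2 * (norm x)\<^sup>2 - r / 2 * (norm y)\<^sup>2)"

end

theory Submission
  imports Defs
begin

text \<open>
  For a differentiable convex concave function, equilibria are exactly the stationary points
  (\<open>equilibrium_imp_stationary\<close>, \<open>stationary_imp_equilibrium\<close>). Write \<open>F\<close> for the gradient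
  of \<open>L\<close>. The gradient of the regularized function is \<open>F (x, y) + r *\<^sub>R (x, - y)\<close>, and that
  function is again convex concave, so the task is to find a small perturbation of \<open>F\<close> with a
  zero close to each zero of \<open>F\<close>.

  One \<open>r\<close> has to serve all equilibria, which is no difficulty because there is only one. The
  equilibria form a convex set (\<open>convex_equilibria\<close>), so a second one would give a whole segment
  of zeros of \<open>F\<close>; but an invertible Hessian makes zeros of \<open>F\<close> isolated.

  For the existence of a zero near the equilibrium \<open>z0\<close>, let \<open>S\<close> be the inverse of the derivative
  of \<open>F\<close> at \<open>z0\<close>. Then \<open>z - S (F z)\<close> is within \<open>norm (z - z0) / 2\<close> of \<open>z0\<close> on some ball. For small \<open>r\<close>
  the extra term \<open>r *\<^sub>R S (P z)\<close>, where \<open>P (x, y) = (x, - y)\<close>, moves points by at most half the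
  radius, so the Newton-like map \<open>z - S (F z + r *\<^sub>R P z)\<close> sends the ball into itself. Its Brouwer
  fixed point is the perturbed zero (\<open>zero_persists_if_derivative_injective\<close>). Existence is all
  that is wanted here, so Brouwer's theorem takes the place of the implicit function theorem.
\<close>

section \<open>Zeros with an invertible derivative\<close>

text \<open>
  Isolation of zeros and their persistence both come from this estimate: since
  \<open>F z = T (z - z0) + o(norm (z - z0))\<close>, applying the inverse of \<open>T\<close> to \<open>F z\<close> recovers \<open>z - z0\<close> up to
  a small relative error. The factor \<open>1 / 2\<close> leaves the other half of a ball's radius free for a
  perturbation.
\<close>

lemma inverse_derivative_estimate:
  fixes F T :: "'a::euclidean_space \<Rightarrow> 'a"
  assumes F: "(F has_derivative T) (at z0)" and z0: "F z0 = 0"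
    and ker: "\<And>v. T v = 0 \<Longrightarrow> v = 0"
  obtains S \<delta> where "linear S" "\<And>v. T (S v) = v" "\<delta> > 0"
    "\<And>z. norm (z - z0) \<le> \<delta> \<Longrightarrow> norm (z - z0 - S (F z)) \<le> norm (z - z0) / 2"
proof -
  have "linear T"
    using F has_derivative_linear by blast
  moreover from this have "inj T"
    using ker linear_injective_0 by blast
  ultimately obtain S where S: "linear S" "\<And>v. T (S v) = v" "\<And>v. S (T v) = v"
    using linear_injective_isomorphism by blast
  obtain K where K: "K > 0" "\<And>v. norm (S v) \<le> K * norm v"
    using linear_bounded_pos[OF S(1)] by blast
  \<comment> \<open>This relative accuracy of the linearization becomes \<open>1 / 2\<close> once \<open>S\<close>, of norm at most \<open>K\<close>,
    is applied.\<close>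
  have "1 / (2 * K) > 0"
    using K by simp
  then obtain \<delta> where \<delta>: "\<delta> > 0"
    "\<And>z. norm (z - z0) < \<delta> \<Longrightarrow> norm (F z - F z0 - T (z - z0)) \<le> 1 / (2 * K) * norm (z - z0)"
    using F unfolding has_derivative_at_alt by blast
  show thesis
  proof (rule that[OF S(1,2)])
    show "\<delta> / 2 > 0"
      using \<delta>(1) by simp
    fix z assume "norm (z - z0) \<le> \<delta> / 2"
    then have near: "norm (F z - T (z - z0)) \<le> 1 / (2 * K) * norm (z - z0)"
      using \<delta>(2)[of z] \<delta>(1) z0 by simp
    have "norm (z - z0 - S (F z)) = norm (S (F z - T (z - z0)))"
      by (simp add: linear_diff[OF S(1)] S(3) norm_minus_commute)
    also have "\<dots> \<le> K * (1 / (2 * K) * norm (z - z0))"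
      using K(2) mult_left_mono[OF near] K(1) order_trans by (meson less_imp_le)
    also have "\<dots> = norm (z - z0) / 2"
      using K(1) by simp
    finally show "norm (z - z0 - S (F z)) \<le> norm (z - z0) / 2" .
  qed
qed

text \<open>
  If \<open>F z = 0\<close>, the estimate reads \<open>norm (z - z0) \<le> norm (z - z0) / 2\<close>.
\<close>

lemma zero_isolated_if_derivative_injective:
  fixes F T :: "'a::euclidean_space \<Rightarrow> 'a"
  assumes "(F has_derivative T) (at z0)" "F z0 = 0" "\<And>v. T v = 0 \<Longrightarrow> v = 0"
  obtains \<delta> where "\<delta> > 0" "\<And>z. norm (z - z0) \<le> \<delta> \<Longrightarrow> F z = 0 \<Longrightarrow> z = z0"
proof -
  obtain S \<delta> where S: "linear S" "\<delta> > 0"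
    "\<And>z. norm (z - z0) \<le> \<delta> \<Longrightarrow> norm (z - z0 - S (F z)) \<le> norm (z - z0) / 2"
    using inverse_derivative_estimate[OF assms] by metis
  have "z = z0" if "norm (z - z0) \<le> \<delta>" "F z = 0" for z
    using S(3)[OF that(1)] that(2) linear_0[OF S(1)] by simp
  then show thesis
    using that S(2) by blast
qed

text \<open>
  Zeros of \<open>F + r *\<^sub>R P\<close> are the fixed points of \<open>h z = z - S (F z + r *\<^sub>R P z)\<close>, because \<open>S\<close> is
  injective; for small \<open>r\<close> Brouwer's theorem applies to \<open>h\<close> on a small ball around \<open>z0\<close>.
\<close>

lemma zero_persists_if_derivative_injective:
  fixes F P T :: "'a::euclidean_space \<Rightarrow> 'a"
  assumes "(F has_derivative T) (at z0)" "F z0 = 0" "\<And>v. T v = 0 \<Longrightarrow> v = 0"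
    and contF: "continuous_on UNIV F" and contP: "continuous_on UNIV P" and "\<epsilon> > 0"
  obtains r z where "r > 0" "norm (z - z0) \<le> \<epsilon>" "F z + r *\<^sub>R P z = 0"
proof -
  obtain S \<delta> where S: "linear S" "\<And>v. T (S v) = v" "\<delta> > 0"
    "\<And>z. norm (z - z0) \<le> \<delta> \<Longrightarrow> norm (z - z0 - S (F z)) \<le> norm (z - z0) / 2"
    using inverse_derivative_estimate[OF assms(1-3)] by metis
  define \<rho> where "\<rho> = min \<delta> \<epsilon>"
  have \<rho>: "\<rho> > 0" "\<rho> \<le> \<delta>" "\<rho> \<le> \<epsilon>"
    using S(3) \<open>\<epsilon> > 0\<close> by (auto simp: \<rho>_def)
  have contS: "continuous_on X S" for X
    using S(1) linear_continuous_on linear_conv_bounded_linear by blast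
  have contSF: "continuous_on X (\<lambda>z. S (F z))" and contSP: "continuous_on X (\<lambda>z. S (P z))" for X
    using continuous_on_compose2[OF contS[of UNIV]] continuous_on_subset[OF contF]
      continuous_on_subset[OF contP] by blast+
  have "bounded ((\<lambda>z. S (P z)) ` cball z0 \<rho>)"
    by (intro compact_imp_bounded compact_continuous_image contSP compact_cball)
  then obtain M where M: "M > 0" "\<And>z. z \<in> cball z0 \<rho> \<Longrightarrow> norm (S (P z)) \<le> M"
    unfolding bounded_pos by blast
  \<comment> \<open>Keeps the perturbation within the half of the radius left over by the estimate.\<close>
  define r where "r = \<rho> / (2 * M)"
  have r: "r > 0" "r * M = \<rho> / 2"
    using \<rho>(1) M(1) by (auto simp: r_def)
  define h where "h = (\<lambda>z. z - S (F z) - r *\<^sub>R S (P z))"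
  have "h z \<in> cball z0 \<rho>" if z: "z \<in> cball z0 \<rho>" for z
  proof -
    have nz: "norm (z - z0) \<le> \<rho>"
      using z by (simp add: dist_norm norm_minus_commute)
    have "h z - z0 = (z - z0 - S (F z)) - r *\<^sub>R S (P z)"
      by (simp add: h_def)
    then have "norm (h z - z0) \<le> norm (z - z0 - S (F z)) + norm (r *\<^sub>R S (P z))"
      by (metis norm_triangle_ineq4)
    also have "\<dots> \<le> \<rho> / 2 + r * M"
      using S(4)[of z] nz \<rho>(2) M(2)[OF z] r(1) by (intro add_mono) (auto intro: mult_left_mono)
    finally show ?thesis
      using r(2) by (simp add: dist_norm norm_minus_commute)
  qed
  moreover have "continuous_on (cball z0 \<rho>) h"
    unfolding h_def by (intro continuous_intros contSF contSP)
  ultimately obtain z where z: "z \<in> cball z0 \<rho>" "h z = z"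
    using brouwer_ball[OF \<rho>(1), of z0 h] by blast
  have "S (F z + r *\<^sub>R P z) = 0"
    using z(2) by (simp add: h_def linear_add[OF S(1)] linear_scale[OF S(1)] algebra_simps)
  then have "F z + r *\<^sub>R P z = 0"
    using S(2) linear_0[OF has_derivative_linear[OF assms(1)]] by metis
  then show thesis
    using that[OF r(1), of z] z(1) \<rho>(3) by (simp add: dist_norm norm_minus_commute)
qed

section \<open>Equilibria and stationary points\<close>

text \<open>
  Along the segment from \<open>p\<close> to \<open>x\<close>, convexity bounds every difference quotient at \<open>p\<close> by
  \<open>f x - f p\<close>, and these quotients tend to the directional derivative, which vanishes.
\<close>

lemma convex_stationary_imp_global_min:
  fixes f :: "'a::real_normed_vector \<Rightarrow> real"
  assumes conv: "convex_on UNIV f" and der: "(f has_derivative (\<lambda>_. 0)) (at p)"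
  shows "f p \<le> f x"
proof (rule ccontr)
  assume "\<not> f p \<le> f x"
  then have lt: "f x < f p" by simp
  have der': "((\<lambda>t. f (p + t *\<^sub>R (x - p))) has_real_derivative 0) (at 0)"
  proof -
    have "((\<lambda>t. f (p + t *\<^sub>R (x - p))) has_derivative (\<lambda>_. 0)) (at 0)"
      by (rule has_derivative_compose[where g=f and g'="\<lambda>_. 0", simplified])
        (auto intro!: derivative_eq_intros simp: der)
    then show ?thesis
      by (simp add: has_field_derivative_def mult.commute[of 0] lambda_zero)
  qed
  have "((\<lambda>t. (f (p + t *\<^sub>R (x - p)) - f p) / t) \<longlongrightarrow> 0) (at_right 0)"
    using DERIV_D[OF der'] by (auto intro: tendsto_mono[OF at_le])
  moreover have "\<forall>\<^sub>F t in at_right 0. (f (p + t *\<^sub>R (x - p)) - f p) / t \<le> f x - f p"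
  proof (rule eventually_at_rightI[of 0 1])
    fix t :: real assume t: "t \<in> {0<..<1}"
    have "p + t *\<^sub>R (x - p) = (1 - t) *\<^sub>R p + t *\<^sub>R x"
      by (simp add: algebra_simps)
    then have "f (p + t *\<^sub>R (x - p)) \<le> (1 - t) * f p + t * f x"
      using convex_onD[OF conv, of t p x] t by simp
    then show "(f (p + t *\<^sub>R (x - p)) - f p) / t \<le> f x - f p"
      using t by (simp add: divide_simps algebra_simps)
  qed simp
  ultimately have "0 \<le> f x - f p"
    by (intro tendsto_upperbound) auto
  then show False using lt by simp
qed

text \<open>
  The two partial functions through an equilibrium have an extremum there, so both partial
  derivatives vanish, and the derivative is their sum.
\<close>

lemma equilibrium_imp_stationary:
  fixes L :: "'a::real_normed_vector \<times> 'b::real_normed_vector \<Rightarrow> real"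
  assumes eq: "equilibrium L z" and der: "(L has_derivative D) (at z)"
  shows "D = (\<lambda>_. 0)"
proof -
  obtain p q where z: "z = (p, q)" by (cases z)
  have "((\<lambda>x. L (x, q)) has_derivative (\<lambda>h. D (h, 0))) (at p)"
    by (rule has_derivative_compose[where g=L and f="\<lambda>x. (x, q)"])
      (auto intro!: derivative_eq_intros simp: der[unfolded z])
  moreover have "\<forall>x. L (p, q) \<le> L (x, q)"
    using eq by (simp add: equilibrium_def z)
  ultimately have Dx: "(\<lambda>h. D (h, 0)) = (\<lambda>_. 0)"
    using differential_zero_maxmin[of p UNIV] by blast
  have "((\<lambda>y. L (p, y)) has_derivative (\<lambda>h. D (0, h))) (at q)"
    by (rule has_derivative_compose[where g=L and f="\<lambda>y. (p, y)"])
      (auto intro!: derivative_eq_intros simp: der[unfolded z])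
  moreover have "\<forall>y. L (p, y) \<le> L (p, q)"
    using eq by (simp add: equilibrium_def z)
  ultimately have Dy: "(\<lambda>h. D (0, h)) = (\<lambda>_. 0)"
    using differential_zero_maxmin[of q UNIV] by blast
  have "D (h, k) = D (h, 0) + D (0, k)" for h k
    using linear_add[OF has_derivative_linear[OF der], of "(h, 0)" "(0, k)"] by simp
  then show ?thesis
    using fun_cong[OF Dx] fun_cong[OF Dy] by auto
qed

lemma stationary_imp_equilibrium:
  fixes L :: "'a::real_normed_vector \<times> 'b::real_normed_vector \<Rightarrow> real"
  assumes cc: "convex_concave L" and der: "(L has_derivative (\<lambda>_. 0)) (at z)"
  shows "equilibrium L z"
proof -
  obtain p q where z: "z = (p, q)" by (cases z)
  have "((\<lambda>x. L (x, q)) has_derivative (\<lambda>_. 0)) (at p)"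
    by (rule has_derivative_compose[where g=L and g'="\<lambda>_. 0" and f="\<lambda>x. (x, q)" and f'="\<lambda>h. (h, 0)", simplified])
      (auto intro!: derivative_eq_intros simp: der[unfolded z])
  then have "L (p, q) \<le> L (x, q)" for x
    using cc convex_stationary_imp_global_min unfolding convex_concave_def by blast
  moreover have "((\<lambda>y. - L (p, y)) has_derivative (\<lambda>_. - 0)) (at q)"
    by (rule has_derivative_minus, rule has_derivative_compose[where g=L and g'="\<lambda>_. 0" and f="\<lambda>y. (p, y)" and f'="\<lambda>h. (0, h)", simplified])
      (auto intro!: derivative_eq_intros simp: der[unfolded z])
  then have "- L (p, q) \<le> - L (p, y)" for y
    using cc convex_stationary_imp_global_min[of "\<lambda>y. - L (p, y)" q y]
    unfolding convex_concave_def concave_on_def by simp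
  ultimately show ?thesis
    by (simp add: equilibrium_def z)
qed

text \<open>
  All equilibria share one value \<open>c\<close>: comparing both with the mixed points \<open>(p, q')\<close> and \<open>(p', q)\<close>
  gives the two inequalities. Hence \<open>(p, q)\<close> is an equilibrium as soon as
  \<open>L (p, y) \<le> c \<le> L (x, q)\<close> for all \<open>x\<close> and \<open>y\<close>. The first bound passes to convex combinations
  in \<open>p\<close> by convexity of \<open>L\<close> in its first argument, the second to those in \<open>q\<close> by concavity in the other.
\<close>

lemma convex_equilibria:
  fixes L :: "'a::real_vector \<times> 'b::real_vector \<Rightarrow> real"
  assumes cc: "convex_concave L"
  shows "convex {z. equilibrium L z}"
proof (rule convexI)
  fix z w and u v :: real
  assume zw: "z \<in> {z. equilibrium L z}" "w \<in> {z. equilibrium L z}" and uv: "0 \<le> u" "0 \<le> v" "u + v = 1"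
  obtain p q p' q' where z: "z = (p, q)" and w: "w = (p', q')"
    by (cases z, cases w)
  define c where "c = L (p, q)"
  have eqs: "L (p, y) \<le> L (p, q)" "L (p, q) \<le> L (x, q)"
     "L (p', y) \<le> L (p', q')" "L (p', q') \<le> L (x, q')" for x y
    using zw by (auto simp: equilibrium_def z w)
  have c': "L (p', q') = c"
    using eqs(1)[of q'] eqs(2)[of p'] eqs(3)[of q] eqs(4)[of p] by (simp add: c_def)
  have up: "L (u *\<^sub>R p + v *\<^sub>R p', y) \<le> c" for y
  proof -
    have "L (u *\<^sub>R p + v *\<^sub>R p', y) \<le> u * L (p, y) + v * L (p', y)"
      using cc uv by (auto simp: convex_concave_def convex_on_def)
    also have "\<dots> \<le> u * c + v * c"
      using eqs(1,3)[of y] c' uv by (intro add_mono mult_left_mono) (auto simp: c_def)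
    finally show ?thesis
      using uv by (simp flip: distrib_right)
  qed
  have lo: "c \<le> L (x, u *\<^sub>R q + v *\<^sub>R q')" for x
  proof -
    have "u * c + v * c \<le> u * L (x, q) + v * L (x, q')"
      using eqs(2,4)[of x] c' uv by (intro add_mono mult_left_mono) (auto simp: c_def)
    also have "\<dots> \<le> L (x, u *\<^sub>R q + v *\<^sub>R q')"
      using cc uv by (auto simp: convex_concave_def concave_on_iff)
    finally show ?thesis
      using uv by (simp flip: distrib_right)
  qed
  show "u *\<^sub>R z + v *\<^sub>R w \<in> {z. equilibrium L z}"
    using order_trans[OF up lo] by (simp add: equilibrium_def z w)
qed

section \<open>The regularized function\<close>

lemma convex_on_norm_power2: "convex_on UNIV (\<lambda>x::'a::real_normed_vector. (norm x)\<^sup>2)"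
proof (rule convex_onI)
  fix t :: real and x y :: 'a
  assume t: "0 < t" "t < 1"
  have "norm ((1 - t) *\<^sub>R x + t *\<^sub>R y) \<le> (1 - t) * norm x + t * norm y"
    using norm_triangle_ineq[of "(1 - t) *\<^sub>R x" "t *\<^sub>R y"] t by simp
  then have "(norm ((1 - t) *\<^sub>R x + t *\<^sub>R y))\<^sup>2 \<le> ((1 - t) * norm x + t * norm y)\<^sup>2"
    by (rule power_mono) simp
  also have "\<dots> \<le> (1 - t) * (norm x)\<^sup>2 + t * (norm y)\<^sup>2"
    using convex_onD[OF convex_power2, of t "norm x" "norm y"] t by simp
  finally show "(norm ((1 - t) *\<^sub>R x + t *\<^sub>R y))\<^sup>2 \<le> (1 - t) * (norm x)\<^sup>2 + t * (norm y)\<^sup>2" .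
qed simp

lemma convex_concave_regularized:
  fixes L :: "'a::real_normed_vector \<times> 'b::real_normed_vector \<Rightarrow> real"
  assumes cc: "convex_concave L" and r: "r \<ge> 0"
  shows "convex_concave (regularized r L)"
proof -
  have sq: "convex_on UNIV (\<lambda>x::'c::real_normed_vector. r / 2 * (norm x)\<^sup>2)"
    using convex_on_cmul[OF _ convex_on_norm_power2, of "r / 2"] r by simp
  have "convex_on UNIV (\<lambda>x. L (x, y) + r / 2 * (norm x)\<^sup>2 - r / 2 * (norm y)\<^sup>2)" for y
    using cc
    by (intro convex_on_diff convex_on_add sq) (auto simp: convex_concave_def concave_on_const)
  moreover have "concave_on UNIV (\<lambda>y. L (x, y) + r / 2 * (norm x)\<^sup>2 - r / 2 * (norm y)\<^sup>2)" for x
    using cc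
    by (intro concave_on_diff concave_on_add sq) (auto simp: convex_concave_def concave_on_const)
  ultimately show ?thesis
    by (simp add: convex_concave_def regularized_def)
qed

text \<open>
  In terms of gradients, regularizing adds the vector field \<open>r *\<^sub>R (x, - y)\<close>.
\<close>

lemma has_derivative_regularized:
  fixes L :: "'a::real_inner \<times> 'b::real_inner \<Rightarrow> real"
  assumes "(L has_derivative D) (at z)"
  shows "(regularized r L has_derivative (\<lambda>v. D v + r *\<^sub>R (fst z, - snd z) \<bullet> v)) (at z)"
proof -
  have "regularized r L = (\<lambda>z. L z + r / 2 * (fst z \<bullet> fst z) - r / 2 * (snd z \<bullet> snd z))"
    by (auto simp: regularized_def power2_norm_eq_inner)
  then show ?thesis
    by (auto intro!: derivative_eq_intros assms simp: inner_prod_def inner_commute algebra_simps)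
qed

section \<open>The gradient and the Hessian matrix\<close>

text \<open>
  The vector that represents a linear form through the inner product. It turns the derivative,
  a map into linear forms, into the gradient, a vector field on the space itself, as a fixed point
  argument requires.
\<close>

definition riesz :: "('a::euclidean_space \<Rightarrow>\<^sub>L real) \<Rightarrow> 'a" where
  "riesz g = (\<Sum>b\<in>Basis. blinfun_apply g b *\<^sub>R b)"

lemma inner_riesz: "riesz g \<bullet> v = blinfun_apply g v"
proof -
  have "riesz g \<bullet> v = (\<Sum>b\<in>Basis. (v \<bullet> b) *\<^sub>R blinfun_apply g b)"
    by (simp add: riesz_def inner_sum_left inner_commute[of v] mult.commute)
  also have "\<dots> = blinfun_apply g (\<Sum>b\<in>Basis. (v \<bullet> b) *\<^sub>R b)"
    by (simp add: blinfun.sum_right blinfun.scaleR_right)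
  finally show ?thesis
    by (simp add: euclidean_representation)
qed

lemma riesz_eq_0_iff: "riesz g = 0 \<longleftrightarrow> blinfun_apply g = (\<lambda>_. 0)"
proof
  assume "riesz g = 0"
  then show "blinfun_apply g = (\<lambda>_. 0)"
    by (intro ext) (simp flip: inner_riesz)
next
  assume "blinfun_apply g = (\<lambda>_. 0)"
  then show "riesz g = 0"
    by (simp add: riesz_def)
qed

lemma bounded_linear_riesz: "bounded_linear riesz"
  unfolding riesz_def
  by (intro bounded_linear_sum bounded_linear_scaleR_const blinfun.bounded_linear_left)

lemma sum_unit_vec:
  "(\<Sum>k\<in>UNIV. (case k of Inl i \<Rightarrow> fst v $ i | Inr j \<Rightarrow> snd v $ j) *\<^sub>R unit_vec k) = v"
  for v :: "(real ^ 'n) \<times> (real ^ 'm)"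
proof -
  have "(\<Sum>k\<in>UNIV. (case k of Inl i \<Rightarrow> fst v $ i | Inr j \<Rightarrow> snd v $ j) *\<^sub>R unit_vec k)
    = (\<Sum>i\<in>UNIV. (fst v $ i) *\<^sub>R (axis i 1, 0)) + (\<Sum>j\<in>UNIV. (snd v $ j) *\<^sub>R (0, axis j 1))"
    by (subst UNIV_Plus_UNIV[symmetric], subst sum.Plus) (auto simp: unit_vec_def)
  also have "\<dots> = v"
    by (simp add: prod_eq_iff fst_sum snd_sum vec_eq_iff axis_def if_distrib cong: if_cong)
  finally show ?thesis .
qed

lemma hessian_entry:
  assumes f': "\<And>z. (f has_derivative blinfun_apply (f' z)) (at z)"
    and f'': "(f' has_derivative blinfun_apply f'') (at z)"
  shows "hessian f z $ i $ j = blinfun_apply (blinfun_apply f'' (unit_vec i)) (unit_vec j)"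
proof -
  have line: "((\<lambda>t. w + t *\<^sub>R v) has_derivative (\<lambda>t. t *\<^sub>R v)) (at 0)"
    for w v :: "(real ^ 'n) \<times> (real ^ 'm)"
    by (auto intro!: derivative_eq_intros)
  have first_order: "dir_deriv v f = (\<lambda>w. blinfun_apply (f' w) v)" for v
  proof
    fix w
    show "dir_deriv v f w = blinfun_apply (f' w) v"
      using has_derivative_compose[OF line[of w v], of f "blinfun_apply (f' w)"] f'[of w]
      unfolding dir_deriv_def
      by (intro DERIV_imp_deriv) (simp add: has_field_derivative_def blinfun.scaleR_right mult_commute_abs)
  qed
  have "((\<lambda>t. f' (z + t *\<^sub>R unit_vec i)) has_derivative (\<lambda>t. blinfun_apply f'' (t *\<^sub>R unit_vec i))) (at 0)"
    using has_derivative_compose[OF line[of z "unit_vec i"], of f' "blinfun_apply f''"] f'' by simp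
  then have "((\<lambda>t. blinfun_apply (f' (z + t *\<^sub>R unit_vec i)) (unit_vec j)) has_derivative
      (\<lambda>t. blinfun_apply (blinfun_apply f'' (t *\<^sub>R unit_vec i)) (unit_vec j))) (at 0)"
    by (rule bounded_linear.has_derivative[OF blinfun.bounded_linear_left])
  then have "((\<lambda>t. blinfun_apply (f' (z + t *\<^sub>R unit_vec i)) (unit_vec j)) has_real_derivative
      blinfun_apply (blinfun_apply f'' (unit_vec i)) (unit_vec j)) (at 0)"
    by (simp add: has_field_derivative_def blinfun.scaleR_right blinfun.scaleR_left mult_commute_abs)
  then have "dir_deriv (unit_vec i) (\<lambda>w. blinfun_apply (f' w) (unit_vec j)) z
      = blinfun_apply (blinfun_apply f'' (unit_vec i)) (unit_vec j)"
    unfolding dir_deriv_def by (rule DERIV_imp_deriv)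
  then show ?thesis
    by (simp add: hessian_def first_order)
qed

text \<open>
  If \<open>c\<close> lists the coordinates of \<open>v\<close>, then \<open>c v* hessian f z\<close> lists the values of the linear form
  \<open>f'' v\<close> on the standard basis. The row index of the Hessian is the direction of the outer
  derivative, which is why \<open>c\<close> multiplies from the left.
\<close>

lemma second_derivative_injective_if_hessian_invertible:
  assumes f': "\<And>z. (f has_derivative blinfun_apply (f' z)) (at z)"
    and f'': "(f' has_derivative blinfun_apply f'') (at z)"
    and inv: "invertible (hessian f z)" and v: "blinfun_apply f'' v = 0"
  shows "v = 0"
proof -
  define c where "c = (\<chi> k. case k of Inl i \<Rightarrow> fst v $ i | Inr j \<Rightarrow> snd v $ j)"
  have v_eq: "v = (\<Sum>k\<in>UNIV. c $ k *\<^sub>R unit_vec k)"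
    unfolding c_def using sum_unit_vec[of v] by simp
  have "(c v* hessian f z) $ j = 0" for j
  proof -
    have "(c v* hessian f z) $ j
        = (\<Sum>k\<in>UNIV. c $ k * blinfun_apply (blinfun_apply f'' (unit_vec k)) (unit_vec j))"
      by (simp add: vector_matrix_mult_def hessian_entry[OF f' f''])
    also have "\<dots> = blinfun_apply (blinfun_apply f'' (\<Sum>k\<in>UNIV. c $ k *\<^sub>R unit_vec k)) (unit_vec j)"
      by (simp add: blinfun.sum_right blinfun.sum_left blinfun.scaleR_right blinfun.scaleR_left)
    also have "\<dots> = 0"
      using v unfolding v_eq[symmetric] by simp
    finally show ?thesis .
  qed
  then have "c v* hessian f z = 0"
    by (simp add: vec_eq_iff)
  then have "c = 0"
    using inv unfolding invertible_def
    by (metis vector_matrix_mul_assoc vector_matrix_mul_rid vector_matrix_mult_0)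
  then show ?thesis
    using v_eq by simp
qed

section \<open>Approximation of the equilibrium\<close>

theorem theorem6:
  fixes L :: "(real ^ 'n) \<times> (real ^ 'm) \<Rightarrow> real"
  assumes "C2 L"
    and "convex_concave L"
    and "\<exists>z. equilibrium L z"
    and "\<And>z. equilibrium L z \<Longrightarrow> invertible (hessian L z)"
  shows "\<forall>\<epsilon>>0. \<exists>r>0. \<forall>x y. equilibrium L (x, y) \<longrightarrow>
           (\<exists>x' y'. equilibrium (regularized r L) (x', y') \<and>
              (norm (x' - x))\<^sup>2 + (norm (y' - y))\<^sup>2 \<le> \<epsilon>\<^sup>2)"
proof (intro allI impI)
  fix \<epsilon> :: real assume "\<epsilon> > 0"
  obtain L' L'' where L': "\<And>z. (L has_derivative blinfun_apply (L' z)) (at z)"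
    and L'': "\<And>z. (L' has_derivative blinfun_apply (L'' z)) (at z)"
    using \<open>C2 L\<close> unfolding C2_def by blast
  obtain z0 where z0: "equilibrium L z0"
    using assms(3) by blast
  define F where "F = (\<lambda>z. riesz (L' z))"
  define T where "T = (\<lambda>v. riesz (blinfun_apply (L'' z0) v))"
  have F_zero: "F z = 0" if "equilibrium L z" for z
    using equilibrium_imp_stationary[OF that L'] by (simp add: F_def riesz_eq_0_iff)
  have F_der: "(F has_derivative (\<lambda>v. riesz (blinfun_apply (L'' z) v))) (at z)" for z
    unfolding F_def by (rule bounded_linear.has_derivative[OF bounded_linear_riesz L''])
  have F_cont: "continuous_on UNIV F"
    using F_der has_derivative_continuous continuous_at_imp_continuous_on by blast
  have T_ker: "v = 0" if "T v = 0" for v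
  proof -
    have "blinfun_apply (L'' z0) v = 0"
      using that by (intro blinfun_eqI) (simp add: T_def riesz_eq_0_iff)
    then show ?thesis
      using second_derivative_injective_if_hessian_invertible[OF L' L'' assms(4)[OF z0]] by blast
  qed
  note F_z0 = F_der[of z0, folded T_def] F_zero[OF z0] T_ker

  obtain \<delta> where \<delta>: "\<delta> > 0" "\<And>z. norm (z - z0) \<le> \<delta> \<Longrightarrow> F z = 0 \<Longrightarrow> z = z0"
    using zero_isolated_if_derivative_injective[OF F_z0] by blast
  \<comment> \<open>A second equilibrium would put equilibria on the segment arbitrarily close to \<open>z0\<close>.\<close>
  have unique: "z = z0" if z: "equilibrium L z" for z
  proof (rule ccontr)
    assume "z \<noteq> z0"
    \<comment> \<open>A point of the segment that is different from \<open>z0\<close> but within the radius of isolation.\<close>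
    define t where "t = min 1 (\<delta> / norm (z - z0))"
    have t: "0 < t" "t \<le> 1" "t * norm (z - z0) \<le> \<delta>"
      using \<delta>(1) \<open>z \<noteq> z0\<close> by (auto simp: t_def min_def field_simps)
    define w where "w = (1 - t) *\<^sub>R z0 + t *\<^sub>R z"
    have "equilibrium L w"
      using convexD[OF convex_equilibria[OF assms(2)], of z0 z "1 - t" t] z0 z t
      by (simp add: w_def)
    moreover have "w - z0 = t *\<^sub>R (z - z0)"
      by (simp add: w_def algebra_simps)
    ultimately have "t *\<^sub>R (z - z0) = 0"
      using \<delta>(2)[of w] F_zero[of w] t by simp
    then show False
      using t \<open>z \<noteq> z0\<close> by simp
  qed

  have "continuous_on UNIV (\<lambda>z::(real ^ 'n) \<times> (real ^ 'm). (fst z, - snd z))"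
    by (intro continuous_intros)
  from zero_persists_if_derivative_injective[OF F_z0 F_cont this \<open>\<epsilon> > 0\<close>]
  obtain r z where r: "r > 0" and z: "norm (z - z0) \<le> \<epsilon>" "F z + r *\<^sub>R (fst z, - snd z) = 0"
    by blast
  have "blinfun_apply (L' z) v + r *\<^sub>R (fst z, - snd z) \<bullet> v = 0" for v
    using arg_cong[OF z(2), of "\<lambda>g. g \<bullet> v"] unfolding inner_add_left F_def inner_riesz by simp
  then have "(regularized r L has_derivative (\<lambda>_. 0)) (at z)"
    using has_derivative_regularized[OF L'[of z], of r] by simp
  then have eq: "equilibrium (regularized r L) (fst z, snd z)"
    using stationary_imp_equilibrium[OF convex_concave_regularized[OF assms(2)]] r by simp
  have "(norm (fst z - x))\<^sup>2 + (norm (snd z - y))\<^sup>2 \<le> \<epsilon>\<^sup>2" if "equilibrium L (x, y)" for x y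
  proof -
    have "(norm (fst z - x))\<^sup>2 + (norm (snd z - y))\<^sup>2 = (norm (z - z0))\<^sup>2"
      unfolding unique[OF that, symmetric] by (simp add: norm_prod_def)
    then show ?thesis
      using power_mono[OF z(1), of 2] by simp
  qed
  then show "\<exists>r>0. \<forall>x y. equilibrium L (x, y) \<longrightarrow>
           (\<exists>x' y'. equilibrium (regularized r L) (x', y') \<and>
              (norm (x' - x))\<^sup>2 + (norm (y' - y))\<^sup>2 \<le> \<epsilon>\<^sup>2)"
    using r eq by blast
qed

end
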